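(* Let $0<R\leq\infty$. Let $\rho\in(0,R)$ and let $h$ be a positive increasing function on $[\rho,R)$ with $\int_{\rho}^R\frac{h(r)}{r}\,dr=\infty$. Let $\psi_1,\psi_2$ be positive increasing functions on some interval $[a,\infty)$, $a>0$, with $\int_a^\infty\frac{1}{\psi_k(y)}\,dy<\infty$ for $k=1,2$. Let $f$ be an unbounded analytic function on $\{z\in\mathbb{C}:|z|<R\}$. Then there is a set $E\subset[0,R)$ of finite $h$-logarithmic measure and some constant $C>0$ such that \[ M_f(r)\leq C\,\mu_f(r)\sqrt{h(r)\,\psi_2\Big(h(r)\,\psi_1\big(\log M_f(r)\big)\Big)}\quad\text{for all } r\in[0,R)\setminus E. \]
   Context: For an analytic function $f(z)=\sum_{n=0}^\infty a_nz^n$ on $\{z\in\mathbb{C}:|z|<R\}$, $0<R\leq\infty$, the maximum modulus and the maximum term are \[ M_f(r)=\max_{|z|=r}|f(z)|,\qquad \mu_f(r)=\max_{n\geq0}|a_n|r^n,\qquad 0\leq r<R. \] A (measurable) set $E\subset[0,R)$ is said to be of finite $h$-logarithmic measure if $\int_{E\cap[\rho,R)}\frac{h(r)}{r}\,dr<\infty$, where $\rho$ is the left endpoint of the interval $[\rho,R)$ on which $h$ is defined. "Increasing" means nondecreasing (e.g. constant $h=1$ is allowed). The assertion for $r\notin E$ includes that all expressions on the right-hand side are defined for such $r$, i.e. $r\geq\rho$, and the arguments of $\psi_1$ and $\psi_2$ lie in $[a,\infty)$. The constant $C$ and the set $E$ may depend on $f,h,\psi_1,\psi_2$. *)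

theory Defs
  imports "HOL-Complex_Analysis.Complex_Analysis"
begin

(* The radius R is an extended real, so R = \<infinity> (entire functions) is included. *)

definition ico :: "real \<Rightarrow> ereal \<Rightarrow> real set" where
  "ico s R = {r. s \<le> r \<and> ereal r < R}"

definition max_modulus :: "(complex \<Rightarrow> complex) \<Rightarrow> real \<Rightarrow> real" where
  "max_modulus f r = (SUP z\<in>sphere 0 r. norm (f z))"

definition max_term :: "(complex \<Rightarrow> complex) \<Rightarrow> real \<Rightarrow> real" where
  "max_term f r = (SUP n. norm (fps_nth (fps_expansion f 0) n) * r ^ n)"

text \<open>
  For \<open>f\<close> analytic on \<open>eball 0 R\<close> the coefficients in \<open>max_term\<close> are those of the power
  series of \<open>f\<close> on the whole disc, and for \<open>0 \<le> r < R\<close> both suprema are maxima.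
\<close>

lemma fps_expansion_sums:
  assumes "f analytic_on eball 0 R" "z \<in> eball 0 R"
  shows "(\<lambda>n. fps_nth (fps_expansion f 0) n * z ^ n) sums f z"
proof -
  have hol: "f holomorphic_on eball 0 R"
    using assms(1) by (rule analytic_imp_holomorphic)
  have "fps_conv_radius (fps_expansion f 0) \<ge> R"
    by (rule conv_radius_fps_expansion[OF hol])
  moreover have "ereal (norm z) < R"
    using assms(2) by (simp add: in_eball_iff)
  ultimately have "(\<lambda>n. fps_nth (fps_expansion f 0) n * z ^ n) sums eval_fps (fps_expansion f 0) z"
    by (intro sums_eval_fps) auto
  also have "eval_fps (fps_expansion f 0) z = f z"
    using eval_fps_expansion'[OF hol, of z] assms(2) by simp
  finally show ?thesis .
qed

lemma max_modulus_attained: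
  assumes "f analytic_on eball 0 R" "r \<in> ico 0 R"
  shows "\<exists>z\<in>sphere 0 r. max_modulus f r = norm (f z) \<and> (\<forall>w\<in>sphere 0 r. norm (f w) \<le> norm (f z))"
proof -
  have r: "0 \<le> r" "ereal r < R"
    using assms(2) by (auto simp: ico_def)
  have "continuous_on (sphere 0 r) (\<lambda>z. norm (f z))"
  proof (intro continuous_on_norm holomorphic_on_imp_continuous_on)
    show "f holomorphic_on sphere 0 r"
      by (rule holomorphic_on_subset[OF analytic_imp_holomorphic[OF assms(1)]])
         (use r in \<open>auto simp: in_eball_iff\<close>)
  qed
  moreover have "sphere (0::complex) r \<noteq> {}"
    using r by simp
  ultimately obtain z where z: "z \<in> sphere 0 r" "\<forall>w\<in>sphere 0 r. norm (f w) \<le> norm (f z)"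
    using continuous_attains_sup[OF compact_sphere] by metis
  have "max_modulus f r = norm (f z)"
    unfolding max_modulus_def by (rule cSup_eq_maximum) (use z in auto)
  with z show ?thesis by blast
qed

lemma max_term_attained:
  fixes R :: ereal
  assumes "f analytic_on eball 0 R" "r \<in> ico 0 R"
  defines "t \<equiv> (\<lambda>n. norm (fps_nth (fps_expansion f 0) n) * r ^ n)"
  shows "\<exists>n. max_term f r = t n \<and> (\<forall>k. t k \<le> t n)"
proof -
  have r: "0 \<le> r" "ereal r < R"
    using assms(2) by (auto simp: ico_def)
  have t_nonneg: "t k \<ge> 0" for k
    using r by (simp add: t_def)
  have "complex_of_real r \<in> eball 0 R"
    using r by (simp add: in_eball_iff)
  from sums_summable[OF fps_expansion_sums[OF assms(1) this]]
  have "(\<lambda>n. norm (fps_nth (fps_expansion f 0) n * complex_of_real r ^ n)) \<longlonglongrightarrow> 0"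
    by (intro tendsto_norm_zero summable_LIMSEQ_zero)
  then have lim: "t \<longlonglongrightarrow> 0"
    using r by (simp add: t_def norm_mult norm_power)
  have "\<exists>n. \<forall>k. t k \<le> t n"
  proof (cases "\<exists>m. t m > 0")
    case True
    then obtain m where m: "t m > 0" ..
    from order_tendstoD(2)[OF lim m] obtain N where N: "\<And>k. k \<ge> N \<Longrightarrow> t k < t m"
      by (auto simp: eventually_sequentially)
    have "\<exists>n\<in>{..max N m}. \<forall>k\<in>{..max N m}. t k \<le> t n"
    proof -
      have "Max (t ` {..max N m}) \<in> t ` {..max N m}"
        by (rule Max_in) auto
      then obtain n where "n \<in> {..max N m}" "Max (t ` {..max N m}) = t n"
        by blast
      moreover have "t k \<le> Max (t ` {..max N m})" if "k \<in> {..max N m}" for k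
        using that by (intro Max_ge) auto
      ultimately show ?thesis by metis
    qed
    then obtain n where n: "\<And>k. k \<le> max N m \<Longrightarrow> t k \<le> t n"
      by auto
    have "t k \<le> t n" for k
    proof (cases "k \<le> max N m")
      case True then show ?thesis by (rule n)
    next
      case False
      then have "t k < t m" by (intro N) auto
      also have "t m \<le> t n" by (rule n) auto
      finally show ?thesis by simp
    qed
    then show ?thesis by blast
  next
    case False
    then have "t k \<le> t 0" for k
      using t_nonneg[of 0] by (metis not_less order_trans)
    then show ?thesis by blast
  qed
  then obtain n where n: "\<And>k. t k \<le> t n" by blast
  have "max_term f r = t n"
    unfolding max_term_def t_def[symmetric]
    by (rule cSup_eq_maximum) (use n in \<open>auto simp: t_def\<close>)
  with n show ?thesis by blast
qed

definition finite_log_measure :: "(real \<Rightarrow> real) \<Rightarrow> real \<Rightarrow> ereal \<Rightarrow> real set \<Rightarrow> bool" where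
  "finite_log_measure h \<rho> R E \<longleftrightarrow>
     E \<subseteq> ico 0 R \<and> E \<in> sets lebesgue \<and>
     (\<integral>\<^sup>+ r \<in> E \<inter> ico \<rho> R. ennreal (h r / r) \<partial>lebesgue) < \<infinity>"

end

theory Submission
  imports Defs
begin

text \<open>
  Write \<open>f(z) = \<Sum> a\<^sub>n z\<^sup>n\<close>, \<open>b\<^sub>n = |a\<^sub>n|\<close> and \<open>S(r) = \<Sum> b\<^sub>n r\<^sup>n\<close>, so that \<open>M(r) \<le> S(r)\<close>.
  The argument is probabilistic, in the manner of Rosenbloom: for fixed \<open>r\<close> the numbers
  \<open>b\<^sub>n r\<^sup>n / S(r)\<close> are the weights of a distribution on the natural numbers. Its mean is
  \<open>A = r S' / S\<close>, and its variance is \<open>V = r A'\<close>; in terms of \<open>x = ln r\<close> these are the first two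
  derivatives of \<open>ln S\<close>. By Chebyshev's inequality, at least half of the mass lies within
  \<open>sqrt (2 V)\<close> of \<open>A\<close>. There are at most \<open>2 * sqrt (2 V) + 1\<close> indices in this range and each
  contributes at most the maximum term \<open>\<mu>\<close>, so \<open>S\<close> is bounded by a constant times
  \<open>\<mu> * sqrt V\<close> as soon as \<open>V\<close> is bounded away from zero
  (lemma \<open>sum_le_max_term_times_deviation\<close>).

  The mean and the variance are controlled by a growth lemma of Borel type
  (\<open>exceptional_set_integral_le\<close>): if \<open>1 / \<psi>\<close> is integrable near infinity, then the set on which
  \<open>g' > (h / r) \<psi>(g)\<close> has finite \<open>h\<close>-logarithmic measure, since on it \<open>h / r\<close> is dominated by
  \<open>g' / \<psi>(g)\<close>, whose integral is that of \<open>1 / \<psi>\<close> over the range of \<open>g\<close>. Applied to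
  \<open>g = ln S\<close> and to \<open>g = A\<close> this gives \<open>A \<le> h P1(ln S)\<close> and \<open>V \<le> h P2(A)\<close>, hence
  \<open>V \<le> h P2(h P1(ln S))\<close>, off a small set.

  The bound to be shown has \<open>ln M\<close> in place of \<open>ln S\<close>, and \<open>S\<close> may well exceed every fixed power
  of \<open>M\<close>. For this reason the growth lemma is applied with the smaller functions
  \<open>P1(y) = min (\<psi>1(y/4)) (max 1 y)\<^sup>2\<close> and \<open>P2(y) = min (\<psi>2(y)) (max 1 y)\<^sup>2\<close>, whose reciprocals are still
  integrable. If \<open>S \<le> M\<^sup>4\<close>, then \<open>P1(ln S) \<le> \<psi>1(ln M)\<close> and the bound for \<open>S\<close> is what is wanted.
  If \<open>S > M\<^sup>4\<close>, the polynomial bounds on \<open>P1\<close> and \<open>P2\<close> give \<open>S \<le> const * \<mu> h powr (3/2) (ln S)\<^sup>2\<close>; the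
  logarithm is absorbed by \<open>sqrt S\<close>, so \<open>M\<^sup>2 < sqrt S \<le> const * \<mu> h powr (3/2)\<close>. As \<open>\<mu>\<close> and \<open>h\<close>
  are bounded below, \<open>M\<close> is then at most a constant times \<open>\<mu> h\<close>, which the right-hand side
  dominates because \<open>\<psi>2\<close> grows at least linearly and \<open>\<psi>1\<close> is bounded below. This dichotomy is lemma \<open>modulus_estimate\<close>.
\<close>

section \<open>Functions with integrable reciprocal\<close>

text \<open>
  The functions are total and the integrals are over all half-lines, so that the growth lemma can be
  applied no matter where the range of the function to be estimated begins. This matters for \<open>A\<close>,
  which stays bounded if \<open>f\<close> is a polynomial.
\<close>
definition growth_majorant :: "(real \<Rightarrow> real) \<Rightarrow> bool" where
  "growth_majorant \<psi> \<longleftrightarrow> mono \<psi> \<and> (\<forall>y. 0 < \<psi> y) \<and>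
     (\<forall>c. (\<integral>\<^sup>+ y \<in> {c..}. ennreal (1 / \<psi> y) \<partial>lborel) < \<infinity>)"

lemma growth_majorantI:
  assumes mono: "mono \<psi>" and pos: "\<And>y. 0 < \<psi> y"
    and fin: "(\<integral>\<^sup>+ y \<in> {b..}. ennreal (1 / \<psi> y) \<partial>lborel) < \<infinity>"
  shows "growth_majorant \<psi>"
proof -
  have [measurable]: "\<psi> \<in> borel_measurable borel"
    by (rule borel_measurable_mono[OF mono])
  have "(\<integral>\<^sup>+ y \<in> {c..}. ennreal (1 / \<psi> y) \<partial>lborel) < \<infinity>" for c
  proof -
    have "(\<integral>\<^sup>+ y \<in> {c..}. ennreal (1 / \<psi> y) \<partial>lborel) \<le>
        (\<integral>\<^sup>+ y. ennreal (1 / \<psi> c) * indicator {c..b} y + ennreal (1 / \<psi> y) * indicator {b..} y \<partial>lborel)"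
    proof (rule nn_integral_mono)
      fix y
      have "y \<ge> c \<Longrightarrow> 1 / \<psi> y \<le> 1 / \<psi> c"
        using monoD[OF mono, of c y] pos by (simp add: frac_le)
      then show "ennreal (1 / \<psi> y) * indicator {c..} y \<le>
          ennreal (1 / \<psi> c) * indicator {c..b} y + ennreal (1 / \<psi> y) * indicator {b..} y"
        by (auto split: split_indicator simp: ennreal_leI)
    qed
    also have "\<dots> = ennreal (1 / \<psi> c) * emeasure lborel {c..b} +
        (\<integral>\<^sup>+ y \<in> {b..}. ennreal (1 / \<psi> y) \<partial>lborel)"
      by (subst nn_integral_add) (auto simp: nn_integral_cmult_indicator)
    also have "\<dots> < \<infinity>"
      using fin by (auto simp: emeasure_lborel_Icc_eq ennreal_mult_less_top)
    finally show ?thesis .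
  qed
  with mono pos show ?thesis
    by (auto simp: growth_majorant_def)
qed

lemma growth_majorantD:
  assumes "growth_majorant \<psi>"
  shows "mono \<psi>" "0 < \<psi> y" "(\<integral>\<^sup>+ y \<in> {c..}. ennreal (1 / \<psi> y) \<partial>lborel) < \<infinity>"
  using assms by (auto simp: growth_majorant_def)

lemma growth_majorant_measurable:
  "growth_majorant \<psi> \<Longrightarrow> \<psi> \<in> borel_measurable borel"
  by (intro borel_measurable_mono growth_majorantD)

text \<open>
  Continuing \<open>\<psi>\<close> to the left of \<open>a\<close> by its value at \<open>a\<close> keeps it monotone and positive.
\<close>
lemma growth_majorant_extend:
  assumes pos: "\<And>y. a \<le> y \<Longrightarrow> 0 < \<psi> y" and mono: "mono_on {a..} \<psi>"
    and fin: "(\<integral>\<^sup>+ y \<in> {a..}. ennreal (1 / \<psi> y) \<partial>lebesgue) < \<infinity>"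
  shows "growth_majorant (\<lambda>y. \<psi> (max a y))"
proof (rule growth_majorantI[of _ a])
  show "mono (\<lambda>y. \<psi> (max a y))"
    by (intro monoI mono_onD[OF mono]) auto
  show "(\<integral>\<^sup>+ y \<in> {a..}. ennreal (1 / \<psi> (max a y)) \<partial>lborel) < \<infinity>"
  proof -
    have "(\<integral>\<^sup>+ y \<in> {a..}. ennreal (1 / \<psi> (max a y)) \<partial>lborel) =
        (\<integral>\<^sup>+ y \<in> {a..}. ennreal (1 / \<psi> y) \<partial>lborel)"
      by (intro nn_integral_cong) (auto split: split_indicator simp: max_def)
    then show ?thesis
      using fin by (simp add: nn_integral_completion)
  qed
qed (use pos in auto)

lemma growth_majorant_dilate:
  assumes \<psi>: "growth_majorant \<psi>" and k: "0 < k"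
  shows "growth_majorant (\<lambda>y. \<psi> (k * y))"
proof (rule growth_majorantI[of _ 0])
  note [measurable] = growth_majorant_measurable[OF \<psi>]
  show "mono (\<lambda>y. \<psi> (k * y))"
    using k by (intro monoI monoD[OF growth_majorantD(1)[OF \<psi>]]) auto
  show "0 < \<psi> (k * y)" for y
    by (rule growth_majorantD[OF \<psi>])
  have "ennreal k * (\<integral>\<^sup>+ y \<in> {0..}. ennreal (1 / \<psi> (k * y)) \<partial>lborel) =
      (\<integral>\<^sup>+ y \<in> {0..}. ennreal (1 / \<psi> y) \<partial>lborel)"
    using k by (subst nn_integral_real_affine[where c = k and t = 0])
      (auto intro!: arg_cong2[where f = "(*)"] nn_integral_cong
        split: split_indicator simp: zero_le_mult_iff)
  also have "\<dots> < \<infinity>"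
    by (rule growth_majorantD[OF \<psi>])
  finally show "(\<integral>\<^sup>+ y \<in> {0..}. ennreal (1 / \<psi> (k * y)) \<partial>lborel) < \<infinity>"
    using k by (auto simp: ennreal_mult_less_top)
qed

lemma growth_majorant_min:
  assumes \<psi>: "growth_majorant \<psi>" and \<phi>: "growth_majorant \<phi>"
  shows "growth_majorant (\<lambda>y. min (\<psi> y) (\<phi> y))"
proof (rule growth_majorantI[of _ 0])
  note [measurable] = growth_majorant_measurable[OF \<psi>] growth_majorant_measurable[OF \<phi>]
  note pos = growth_majorantD(2)[OF \<psi>] growth_majorantD(2)[OF \<phi>]
  show "mono (\<lambda>y. min (\<psi> y) (\<phi> y))"
    by (intro monoI min.mono monoD[OF growth_majorantD(1)[OF \<psi>]] monoD[OF growth_majorantD(1)[OF \<phi>]])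
  show "0 < min (\<psi> y) (\<phi> y)" for y
    using pos by simp
  have "(\<integral>\<^sup>+ y \<in> {0..}. ennreal (1 / min (\<psi> y) (\<phi> y)) \<partial>lborel) \<le>
      (\<integral>\<^sup>+ y. ennreal (1 / \<psi> y) * indicator {0..} y + ennreal (1 / \<phi> y) * indicator {0..} y \<partial>lborel)"
    using pos by (intro nn_integral_mono) (auto split: split_indicator simp: min_def)
  also have "\<dots> = (\<integral>\<^sup>+ y \<in> {0..}. ennreal (1 / \<psi> y) \<partial>lborel) + (\<integral>\<^sup>+ y \<in> {0..}. ennreal (1 / \<phi> y) \<partial>lborel)"
    by (rule nn_integral_add) auto
  also have "\<dots> < \<infinity>"
    using growth_majorantD(3)[OF \<psi>, of 0] growth_majorantD(3)[OF \<phi>, of 0] by auto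
  finally show "(\<integral>\<^sup>+ y \<in> {0..}. ennreal (1 / min (\<psi> y) (\<phi> y)) \<partial>lborel) < \<infinity>" .
qed

lemma growth_majorant_square: "growth_majorant (\<lambda>y. (max 1 y)\<^sup>2)"
proof (rule growth_majorantI[of _ 1])
  show "mono (\<lambda>y. (max 1 y :: real)\<^sup>2)"
    by (intro monoI power_mono) auto
  show "0 < (max 1 y :: real)\<^sup>2" for y
    by (auto simp: max_def)
  have "(\<integral>\<^sup>+ y \<in> {1..}. ennreal (1 / (max 1 y)\<^sup>2) \<partial>lborel) = (\<integral>\<^sup>+ y. ennreal (1 / y\<^sup>2) * indicator {1..} y \<partial>lborel)"
    by (intro nn_integral_cong) (auto split: split_indicator simp: max_def)
  also have "\<dots> = ennreal (0 - (- (1 / 1)))"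
  proof (rule nn_integral_FTC_atLeast[where F = "\<lambda>y. - (1 / y)" and T = 0])
    show "((\<lambda>y. - (1 / y)) has_real_derivative 1 / y\<^sup>2) (at y)" if "1 \<le> y" for y :: real
      using that by (auto intro!: derivative_eq_intros simp: power2_eq_square)
    show "((\<lambda>y::real. - (1 / y)) \<longlongrightarrow> 0) at_top"
      by real_asymp
  qed auto
  finally show "(\<integral>\<^sup>+ y \<in> {1..}. ennreal (1 / (max 1 y)\<^sup>2) \<partial>lborel) < \<infinity>"
    by simp
qed

text \<open>
  Since \<open>1 / \<psi>\<close> is decreasing, \<open>y / \<psi> y\<close> is at most the integral of \<open>1 / \<psi>\<close> over \<open>{0..y}\<close>.
\<close>
lemma growth_majorant_at_least_linear:
  assumes \<psi>: "growth_majorant \<psi>"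
  obtains c where "0 < c" "\<And>y. c * y \<le> \<psi> y"
proof -
  define I where "I = enn2real (\<integral>\<^sup>+ y \<in> {0..}. ennreal (1 / \<psi> y) \<partial>lborel)"
  have I: "(\<integral>\<^sup>+ y \<in> {0..}. ennreal (1 / \<psi> y) \<partial>lborel) = ennreal I" "0 \<le> I"
    using growth_majorantD(3)[OF \<psi>, of 0] by (auto simp: I_def less_top)
  note pos = growth_majorantD(2)[OF \<psi>]
  have *: "y \<le> (I + 1) * \<psi> y" for y
  proof (cases "0 \<le> y")
    case True
    have "ennreal (1 / \<psi> y * y) = (\<integral>\<^sup>+ t. ennreal (1 / \<psi> y) * indicator {0..y} t \<partial>lborel)"
      using True pos[of y] by (simp add: nn_integral_cmult_indicator flip: ennreal_mult')
    also have "\<dots> \<le> (\<integral>\<^sup>+ y \<in> {0..}. ennreal (1 / \<psi> y) \<partial>lborel)"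
    proof (rule nn_integral_mono)
      fix t
      have "t \<le> y \<Longrightarrow> 1 / \<psi> y \<le> 1 / \<psi> t"
        using monoD[OF growth_majorantD(1)[OF \<psi>], of t y] pos by (simp add: frac_le)
      then show "ennreal (1 / \<psi> y) * indicator {0..y} t \<le> ennreal (1 / \<psi> t) * indicator {0..} t"
        by (auto split: split_indicator simp: ennreal_leI)
    qed
    finally have "1 / \<psi> y * y \<le> I"
      using I by simp
    then have "y \<le> I * \<psi> y"
      using pos[of y] by (simp add: field_simps)
    also have "\<dots> \<le> (I + 1) * \<psi> y"
      using pos[of y] by simp
    finally show ?thesis .
  next
    case False
    moreover have "0 \<le> (I + 1) * \<psi> y"
      using I(2) pos[of y] by simp
    ultimately show ?thesis by linarith
  qed
  show ?thesis
  proof (rule that)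
    show "0 < 1 / (I + 1)" using I(2) by simp
    show "1 / (I + 1) * y \<le> \<psi> y" for y
      using *[of y] I(2) by (simp add: field_simps)
  qed
qed

section \<open>A growth lemma of Borel type\<close>

text \<open>
  On \<open>E\<close> the weight \<open>w\<close> is dominated by \<open>g' / \<psi>(g)\<close>, and the substitution \<open>y = g r\<close> turns the
  integral of the latter into one of \<open>1 / \<psi>\<close>. The substitution is made on compact intervals
  \<open>{s..b i}\<close> exhausting \<open>[s, R)\<close>.
\<close>
lemma exceptional_set_integral_le:
  fixes R :: ereal
  assumes \<psi>: "growth_majorant \<psi>" and sR: "ereal s < R"
    and deriv: "\<And>r. r \<in> ico s R \<Longrightarrow> (g has_real_derivative g' r) (at r)"
    and cont: "continuous_on (ico s R) g'"
    and nonneg: "\<And>r. r \<in> ico s R \<Longrightarrow> 0 \<le> g' r"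
    and E: "\<And>r. r \<in> E \<Longrightarrow> r \<in> ico s R \<and> w r * \<psi> (g r) \<le> g' r"
  shows "(\<integral>\<^sup>+ r \<in> E. ennreal (w r) \<partial>lborel) \<le> (\<integral>\<^sup>+ y \<in> {g s..}. ennreal (1 / \<psi> y) \<partial>lborel)"
proof -
  note [measurable] = growth_majorant_measurable[OF \<psi>]
  note pos = growth_majorantD(2)[OF \<psi>]
  obtain b :: "nat \<Rightarrow> real" where b: "incseq b" "\<And>i. ereal s < b i" "\<And>i. b i < R" "b \<longlonglongrightarrow> R"
    using ereal_incseq_approx[OF sR] by blast
  have sb: "{s..b i} \<subseteq> ico s R" for i
    using b(3)[of i] by (auto simp: ico_def intro: le_less_trans[of _ "ereal (b i)"])
  define G where "G i r = ennreal (1 / \<psi> (g r) * g' r) * indicator {s..b i} r" for i r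
  have G_meas: "G i \<in> borel_measurable lborel" for i
  proof -
    have [measurable]: "(\<lambda>r. indicator {s..b i} r *\<^sub>R g r) \<in> borel_measurable borel"
      by (rule borel_measurable_continuous_on_indicator)
        (use sb[of i] in \<open>auto intro!: has_real_derivative_imp_continuous_on deriv\<close>)
    have [measurable]: "(\<lambda>r. indicator {s..b i} r *\<^sub>R g' r) \<in> borel_measurable borel"
      by (rule borel_measurable_continuous_on_indicator)
        (use sb[of i] in \<open>auto intro!: continuous_on_subset[OF cont]\<close>)
    have "G i = (\<lambda>r. ennreal (1 / \<psi> (indicator {s..b i} r *\<^sub>R g r) * (indicator {s..b i} r *\<^sub>R g' r)) * indicator {s..b i} r)"
      by (auto simp: G_def split: split_indicator)
    also have "\<dots> \<in> borel_measurable lborel"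
      by measurable
    finally show ?thesis .
  qed
  have "incseq G"
  proof (intro incseq_SucI le_funI)
    fix i r
    show "G i r \<le> G (Suc i) r"
      using incseq_SucD[OF b(1), of i] by (auto simp: G_def split: split_indicator)
  qed
  have G_int: "integral\<^sup>N lborel (G i) \<le> (\<integral>\<^sup>+ y \<in> {g s..}. ennreal (1 / \<psi> y) \<partial>lborel)" for i
  proof -
    have sbi: "s \<le> b i" using b(2)[of i] by simp
    have "integral\<^sup>N lborel (G i) = (\<integral>\<^sup>+ r. ennreal (1 / \<psi> (g r) * g' r * indicator {s..b i} r) \<partial>lborel)"
      by (intro nn_integral_cong) (auto simp: G_def split: split_indicator)
    also have "\<dots> = (\<integral>\<^sup>+ y. ennreal (1 / \<psi> y * indicator {g s..g (b i)} y) \<partial>lborel)"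
      using sb[of i] sbi
      by (intro nn_integral_substitution[symmetric] deriv nonneg continuous_on_subset[OF cont])
        (auto simp: set_borel_measurable_def)
    also have "\<dots> \<le> (\<integral>\<^sup>+ y \<in> {g s..}. ennreal (1 / \<psi> y) \<partial>lborel)"
      by (intro nn_integral_mono) (auto split: split_indicator)
    finally show ?thesis .
  qed
  have "(\<integral>\<^sup>+ r \<in> E. ennreal (w r) \<partial>lborel) \<le> (\<integral>\<^sup>+ r. (SUP i. G i r) \<partial>lborel)"
  proof (rule nn_integral_mono)
    fix r
    show "ennreal (w r) * indicator E r \<le> (SUP i. G i r)"
    proof (cases "r \<in> E")
      case True
      from E[OF this] have r: "s \<le> r" "ereal r < R" and wr: "w r \<le> 1 / \<psi> (g r) * g' r"
        using pos[of "g r"] by (auto simp: ico_def field_simps)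
      from order_tendstoD(1)[OF b(4) r(2)] obtain i where "ereal r < b i"
        by (auto simp: eventually_sequentially)
      then have "ennreal (w r) \<le> G i r"
        using r wr by (simp add: G_def ennreal_leI)
      also have "\<dots> \<le> (SUP i. G i r)"
        by (rule SUP_upper) simp
      finally show ?thesis using True by simp
    qed simp
  qed
  also have "\<dots> = (SUP i. integral\<^sup>N lborel (G i))"
    by (rule nn_integral_monotone_convergence_SUP[OF \<open>incseq G\<close> G_meas])
  also have "\<dots> \<le> (\<integral>\<^sup>+ y \<in> {g s..}. ennreal (1 / \<psi> y) \<partial>lborel)"
    by (intro SUP_least G_int)
  finally show ?thesis .
qed


section \<open>Power series and the distribution of their terms\<close>

text \<open>
  The moments of the distribution arise from \<open>S\<close> by iterating the Euler operator \<open>x d/dx\<close>, which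
  multiplies the \<open>n\<close>-th coefficient by \<open>n\<close>. Stating the rule with summability on \<open>(0, R)\<close> both as
  hypothesis and as conclusion allows this iteration.
\<close>
lemma power_series_euler_operator:
  fixes c :: "nat \<Rightarrow> real" and R :: ereal
  assumes sm: "\<And>x. 0 < x \<Longrightarrow> ereal x < R \<Longrightarrow> summable (\<lambda>n. c n * x ^ n)"
    and x: "0 < x" "ereal x < R"
  shows "summable (\<lambda>n. real n * c n * x ^ n)"
    and "((\<lambda>x. \<Sum>n. c n * x ^ n) has_real_derivative (\<Sum>n. real n * c n * x ^ n) / x) (at x)"
proof -
  obtain K where K: "x < K" "ereal K < R"
    using ereal_dense2[OF x(2)] by auto
  have smK: "summable (\<lambda>n. c n * K ^ n)"
    using K x by (intro sm) auto
  have "summable (\<lambda>n. diffs c n * x ^ n)"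
  proof (rule termdiff_converges)
    show "norm x < K" using x K by simp
    show "summable (\<lambda>n. c n * y ^ n)" if "norm y < K" for y
      by (rule powser_inside[OF smK]) (use that in auto)
  qed
  from diffs_equiv[OF this]
  have "(\<lambda>n. x * (real n * c n * x ^ (n - Suc 0))) sums (x * (\<Sum>n. diffs c n * x ^ n))"
    by (intro sums_mult) simp
  also have "(\<lambda>n. x * (real n * c n * x ^ (n - Suc 0))) = (\<lambda>n. real n * c n * x ^ n)"
  proof
    show "x * (real n * c n * x ^ (n - Suc 0)) = real n * c n * x ^ n" for n
      by (cases n) auto
  qed
  finally have *: "(\<lambda>n. real n * c n * x ^ n) sums (x * (\<Sum>n. diffs c n * x ^ n))" .
  then show "summable (\<lambda>n. real n * c n * x ^ n)"
    by (rule sums_summable)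
  have "((\<lambda>x. \<Sum>n. c n * x ^ n) has_real_derivative (\<Sum>n. diffs c n * x ^ n)) (at x)"
    by (rule termdiffs_strong[OF smK]) (use x K in auto)
  also have "(\<Sum>n. diffs c n * x ^ n) = (\<Sum>n. real n * c n * x ^ n) / x"
    using sums_unique[OF *] x by (metis nonzero_mult_div_cancel_left less_irrefl)
  finally show "((\<lambda>x. \<Sum>n. c n * x ^ n) has_real_derivative (\<Sum>n. real n * c n * x ^ n) / x) (at x)" .
qed

lemma card_nat_near_le:
  fixes A d :: real
  assumes "0 \<le> d"
  shows "finite {n. \<bar>real n - A\<bar> \<le> d}" and "real (card {n. \<bar>real n - A\<bar> \<le> d}) \<le> 2 * d + 1"
proof -
  let ?T = "{n. \<bar>real n - A\<bar> \<le> d}" and ?I = "{\<lceil>A - d\<rceil>..\<lfloor>A + d\<rfloor>}"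
  have sub: "int ` ?T \<subseteq> ?I"
    by (auto simp: ceiling_le_iff le_floor_iff abs_le_iff)
  then have "finite (int ` ?T)"
    by (rule finite_subset) simp
  then show "finite ?T"
    by (simp add: finite_image_iff)
  have "card ?T = card (int ` ?T)"
    by (simp add: card_image)
  also have "\<dots> \<le> card ?I"
    by (rule card_mono[OF _ sub]) simp
  finally have "real (card ?T) \<le> real (nat (\<lfloor>A + d\<rfloor> - \<lceil>A - d\<rceil> + 1))"
    by simp
  also have "\<dots> \<le> 2 * d + 1"
  proof (cases "0 \<le> \<lfloor>A + d\<rfloor> - \<lceil>A - d\<rceil> + 1")
    case True
    then show ?thesis by simp linarith
  qed (use assms in simp)
  finally show "real (card ?T) \<le> 2 * d + 1" .
qed

lemma variance_sums:
  fixes p :: "nat \<Rightarrow> real"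
  assumes "p sums S" "(\<lambda>n. real n * p n) sums (S * A)" "(\<lambda>n. real n ^ 2 * p n) sums (S * (V + A\<^sup>2))"
  shows "(\<lambda>n. (real n - A)\<^sup>2 * p n) sums (S * V)"
proof -
  have "(\<lambda>n. real n ^ 2 * p n - 2 * A * (real n * p n) + A\<^sup>2 * p n) sums
      (S * (V + A\<^sup>2) - 2 * A * (S * A) + A\<^sup>2 * S)"
    by (intro sums_add sums_diff sums_mult assms)
  then show ?thesis
    by (simp add: algebra_simps power2_eq_square)
qed

text \<open>
  Chebyshev's inequality: the indices farther than \<open>sqrt (2 * W)\<close> from the mean carry at most half
  of \<open>S\<close>. The upper bound \<open>W\<close> replaces the variance itself since the latter may vanish, as it does
  for a monomial.
\<close>
lemma sum_le_max_term_times_deviation: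
  fixes p :: "nat \<Rightarrow> real"
  assumes p: "\<And>n. 0 \<le> p n" "\<And>n. p n \<le> \<mu>"
    and S: "p sums S" and V: "(\<lambda>n. (real n - A)\<^sup>2 * p n) sums (S * V)"
    and W: "V \<le> W" "0 < W"
  shows "S \<le> 2 * \<mu> * (2 * sqrt (2 * W) + 1)"
proof -
  define d where "d = sqrt (2 * W)"
  define T where "T = {n. \<bar>real n - A\<bar> \<le> d}"
  have d: "0 < d" "d\<^sup>2 = 2 * W"
    using W by (auto simp: d_def)
  have T: "finite T" "real (card T) \<le> 2 * d + 1"
    using card_nat_near_le[of d A] d by (auto simp: T_def)
  have "0 \<le> \<mu>" using p[of 0] by simp
  have "0 \<le> S" using S p(1) by (auto simp: sums_iff intro: suminf_nonneg)
  have "(\<lambda>n. if n \<in> T then \<mu> else 0) sums (\<Sum>n\<in>T. \<mu>)"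
    by (rule sums_If_finite_set[OF T(1)])
  then have bound_sums: "(\<lambda>n. (if n \<in> T then \<mu> else 0) + (real n - A)\<^sup>2 * p n / d\<^sup>2) sums (card T * \<mu> + S * V / d\<^sup>2)"
    by (intro sums_add sums_divide V) simp
  \<comment> \<open>Markov's inequality applied to the squared deviation, termwise\<close>
  have "p n \<le> (if n \<in> T then \<mu> else 0) + (real n - A)\<^sup>2 * p n / d\<^sup>2" for n
  proof (cases "n \<in> T")
    case True
    have "0 \<le> (real n - A)\<^sup>2 * p n / d\<^sup>2" using p(1)[of n] by simp
    with p(2)[of n] True show ?thesis by simp
  next
    case False
    then have "d\<^sup>2 \<le> \<bar>real n - A\<bar>\<^sup>2"
      using d by (intro power_mono) (auto simp: T_def)
    then have "d\<^sup>2 * p n \<le> (real n - A)\<^sup>2 * p n"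
      using p(1)[of n] by (intro mult_right_mono) auto
    with False d(1) show ?thesis by (simp add: pos_le_divide_eq mult.commute)
  qed
  then have "S \<le> card T * \<mu> + S * V / d\<^sup>2"
    by (rule sums_le[OF _ S bound_sums])
  also have "S * V / d\<^sup>2 \<le> S / 2"
    using mult_left_mono[OF W(1) \<open>0 \<le> S\<close>] W by (simp add: d field_simps)
  also have "card T * \<mu> \<le> (2 * d + 1) * \<mu>"
    using T \<open>0 \<le> \<mu>\<close> by (intro mult_right_mono)
  finally show ?thesis
    by (simp add: d_def algebra_simps)
qed

section \<open>Passing from the sum of moduli to the maximum modulus\<close>

text \<open>
  Here \<open>S\<close>, \<open>A\<close> and \<open>V\<close> are the values at one radius \<open>r\<close> outside the exceptional set, and the last
  premise is the Chebyshev estimate. The point is that \<open>C\<close> depends only on \<open>\<psi>1\<close>, \<open>\<psi>2\<close> and the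
  lower bounds \<open>\<eta>\<close> for \<open>h\<close> and \<open>m\<close> for \<open>\<mu>\<close>, hence not on \<open>r\<close>.
\<close>
lemma modulus_estimate:
  fixes \<psi>1 \<psi>2 :: "real \<Rightarrow> real"
  assumes \<psi>1: "growth_majorant \<psi>1" and \<psi>2: "growth_majorant \<psi>2" and \<eta>: "0 < \<eta>" and m: "0 < m"
  obtains C where "0 < C"
    "\<And>h \<mu> M S A V. \<lbrakk>\<eta> \<le> h; m \<le> \<mu>; 0 < M; 1 \<le> ln M; M \<le> S;
       A \<le> h * min (\<psi>1 (1/4 * ln S)) ((max 1 (ln S))\<^sup>2);
       V \<le> h * min (\<psi>2 A) ((max 1 A)\<^sup>2);
       \<And>W. V \<le> W \<Longrightarrow> 0 < W \<Longrightarrow> S \<le> 2 * \<mu> * (2 * sqrt (2 * W) + 1)\<rbrakk> \<Longrightarrow>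
       M \<le> C * \<mu> * sqrt (h * \<psi>2 (h * \<psi>1 (ln M)))"
proof -
  note mono1 = monoD[OF growth_majorantD(1)[OF \<psi>1]] and mono2 = monoD[OF growth_majorantD(1)[OF \<psi>2]]
  note pos1 = growth_majorantD(2)[OF \<psi>1] and pos2 = growth_majorantD(2)[OF \<psi>2]
  obtain c where c: "0 < c" "\<And>y. c * y \<le> \<psi>2 y"
    using growth_majorant_at_least_linear[OF \<psi>2] by blast
  define P1 where "P1 y = min (\<psi>1 (1/4 * y)) ((max 1 y)\<^sup>2)" for y
  define P2 where "P2 y = min (\<psi>2 y) ((max 1 y)\<^sup>2)" for y
  \<comment> \<open>\<open>w\<close> is a lower bound for \<open>W\<close> below: it absorbs the summand 1 in the Chebyshev estimate into
    \<open>D\<close>. The factor \<open>\<kappa>\<close> makes \<open>\<kappa> * h \<ge> 1\<close>, and \<open>K\<close> is what the case \<open>S > M ^ 4\<close> demands.\<close>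
  define w where "w = \<eta> * min (\<psi>2 0) 1"
  define D where "D = 2 * (2 * sqrt 2 + 1 / sqrt w)"
  define \<kappa> where "\<kappa> = max 1 (1 / \<eta>)"
  define K where "K = 16 * D * \<kappa> / (sqrt \<eta> * (c * \<psi>1 0) * m)"
  have w: "0 < w" using \<eta> pos2[of 0] by (simp add: w_def)
  have D: "0 < D" using w by (simp add: D_def add_pos_pos)
  have \<kappa>: "1 \<le> \<kappa>" "1 \<le> \<kappa> * \<eta>" using \<eta> by (auto simp: \<kappa>_def max_def field_simps)
  have K: "0 < K" using D \<kappa> c \<eta> m pos1[of 0] by (simp add: K_def)
  have Keq: "16 * D * \<kappa> = K * (sqrt \<eta> * (c * \<psi>1 0) * m)"
    using c \<eta> m pos1[of 0] by (simp add: K_def)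
  show ?thesis
  proof (rule that[of "D + sqrt K"])
    show "0 < D + sqrt K" using D K by (simp add: add_pos_pos)
    fix h \<mu> M S A V :: real
    assume h: "\<eta> \<le> h" and \<mu>: "m \<le> \<mu>" and M: "0 < M" "1 \<le> ln M" and MS: "M \<le> S"
      and A: "A \<le> h * min (\<psi>1 (1/4 * ln S)) ((max 1 (ln S))\<^sup>2)"
      and V: "V \<le> h * min (\<psi>2 A) ((max 1 A)\<^sup>2)"
      and cheb: "\<And>W. V \<le> W \<Longrightarrow> 0 < W \<Longrightarrow> S \<le> 2 * \<mu> * (2 * sqrt (2 * W) + 1)"
    have h0: "0 < h" using h \<eta> by simp
    have \<mu>0: "0 < \<mu>" using \<mu> m by simp
    have S0: "0 < S" using M MS by simp
    have L1: "1 \<le> ln S" using M(2) ln_mono[OF MS M(1)] by linarith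
    define Q where "Q = h * P1 (ln S)"
    define W where "W = h * P2 Q"
    have "0 \<le> Q"
      using h0 pos1[of "1/4 * ln S"] by (simp add: Q_def P1_def)
    have AQ: "A \<le> Q" using A by (simp add: Q_def P1_def)
    have "P2 A \<le> P2 Q"
      unfolding P2_def using AQ by (intro min.mono mono2 power_mono) auto
    then have "h * P2 A \<le> W"
      unfolding W_def using h0 by (intro mult_left_mono) auto
    then have VW: "V \<le> W"
      using V by (simp add: P2_def)
    have "min (\<psi>2 0) 1 \<le> P2 Q"
      unfolding P2_def using \<open>0 \<le> Q\<close> by (intro min.mono mono2) (auto simp: max_def)
    then have wW: "w \<le> W"
      unfolding w_def W_def using h \<eta> pos2[of 0] by (intro mult_mono) auto
    have "1 \<le> sqrt W / sqrt w"
      using wW w by simp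
    moreover have "D / 2 * sqrt W = 2 * sqrt (2 * W) + sqrt W / sqrt w"
      by (simp add: D_def real_sqrt_mult algebra_simps)
    ultimately have "2 * sqrt (2 * W) + 1 \<le> D / 2 * sqrt W"
      by linarith
    then have "2 * \<mu> * (2 * sqrt (2 * W) + 1) \<le> 2 * \<mu> * (D / 2 * sqrt W)"
      using \<mu>0 by (intro mult_left_mono) auto
    with cheb[OF VW] wW w have S_le: "S \<le> D * \<mu> * sqrt W"
      by (simp add: algebra_simps)
    let ?X = "h * \<psi>2 (h * \<psi>1 (ln M))"
    have X0: "0 < ?X" using h0 pos2 by simp
    show "M \<le> (D + sqrt K) * \<mu> * sqrt ?X"
    \<comment> \<open>The exponent 4 leaves room in the second case: after \<open>(ln S)\<^sup>2\<close> has been absorbed by \<open>sqrt S\<close>,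
      there remains \<open>sqrt S > M\<^sup>2\<close>, and \<open>M\<^sup>2\<close> may be compared with the square of the claimed bound.\<close>
    proof (cases "S \<le> M ^ 4")
      case True
      then have "ln S \<le> ln (M ^ 4)"
        using S0 M by simp
      also have "ln (M ^ 4) = 4 * ln M"
        using M by (simp add: ln_realpow)
      finally have "\<psi>1 (1/4 * ln S) \<le> \<psi>1 (ln M)"
        by (intro mono1) auto
      then have "Q \<le> h * \<psi>1 (ln M)"
        using h0 by (auto simp: Q_def P1_def min_le_iff_disj)
      then have "P2 Q \<le> \<psi>2 (h * \<psi>1 (ln M))"
        using mono2 by (auto simp: P2_def min_le_iff_disj)
      then have "W \<le> ?X"
        using h0 by (simp add: W_def)
      have "M \<le> D * \<mu> * sqrt W" using MS S_le by simp
      also have "\<dots> \<le> D * \<mu> * sqrt ?X"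
        using \<open>W \<le> ?X\<close> D \<mu>0 by (intro mult_left_mono) auto
      also have "\<dots> \<le> (D + sqrt K) * \<mu> * sqrt ?X"
        using K \<mu>0 X0 by (intro mult_right_mono) auto
      finally show ?thesis .
    next
      case False
      define u where "u = sqrt S"
      have u: "0 < u" "u\<^sup>2 = S" using S0 by (auto simp: u_def)
      have "(M\<^sup>2)\<^sup>2 < u\<^sup>2" using False u by simp
      then have Mu: "M\<^sup>2 < u" using u by (meson power2_less_imp_less less_imp_le)
      have "ln S = 4 * ln (sqrt u)"
        using u by (simp add: ln_sqrt ln_realpow flip: u(2))
      also have "\<dots> \<le> 4 * sqrt u"
        using u ln_bound[of "sqrt u"] by simp
      finally have "(ln S)\<^sup>2 \<le> (4 * sqrt u)\<^sup>2"
        using L1 by (intro power_mono) auto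
      also have "\<dots> = 16 * u"
        using u by (simp add: power_mult_distrib)
      finally have L_le: "(ln S)\<^sup>2 \<le> 16 * u" .
      have "Q \<le> h * (ln S)\<^sup>2"
        using h0 L1 by (simp add: Q_def P1_def)
      also have "\<dots> \<le> \<kappa> * h * (ln S)\<^sup>2"
        using \<kappa> h0 by (intro mult_right_mono) auto
      finally have "Q \<le> \<kappa> * h * (ln S)\<^sup>2" .
      moreover have "1 \<le> \<kappa> * h * (ln S)\<^sup>2"
      proof -
        have "1 \<le> \<kappa> * \<eta>" by fact
        also have "\<dots> \<le> \<kappa> * h" using h \<kappa> by (intro mult_left_mono) auto
        finally have "1 * 1 \<le> \<kappa> * h * (ln S)\<^sup>2"
          using L1 by (intro mult_mono) (auto simp: one_le_power)
        then show ?thesis by simp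
      qed
      ultimately have "P2 Q \<le> (\<kappa> * h * (ln S)\<^sup>2)\<^sup>2"
        by (auto simp: P2_def min_le_iff_disj intro!: power_mono)
      then have "W \<le> h * (\<kappa> * h * (ln S)\<^sup>2)\<^sup>2"
        using h0 by (simp add: W_def)
      then have "sqrt W \<le> sqrt (h * (\<kappa> * h * (ln S)\<^sup>2)\<^sup>2)"
        by simp
      also have "\<dots> = sqrt h * (\<kappa> * h * (ln S)\<^sup>2)"
        using \<kappa> h0 by (simp add: real_sqrt_mult)
      also have "\<dots> \<le> sqrt h * (\<kappa> * h * (16 * u))"
        using L_le \<kappa> h0 by (intro mult_left_mono) auto
      finally have "D * \<mu> * sqrt W \<le> D * \<mu> * (sqrt h * (\<kappa> * h * (16 * u)))"
        using D \<mu>0 by (intro mult_left_mono) auto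
      with S_le u(2) have "u * u \<le> (16 * D * \<kappa> * \<mu> * h * sqrt h) * u"
        by (simp add: power2_eq_square mult_ac)
      then have "u \<le> 16 * D * \<kappa> * \<mu> * h * sqrt h"
        using u(1) by simp
      also have "\<dots> = K * (c * \<psi>1 0) * (m * \<mu>) * (sqrt \<eta> * sqrt h) * h"
        unfolding Keq by (simp add: mult_ac)
      also have "\<dots> \<le> K * (c * \<psi>1 0) * (\<mu> * \<mu>) * (sqrt h * sqrt h) * h"
        using K c pos1[of 0] h h0 \<mu> \<mu>0 m \<eta> by (intro mult_mono mult_nonneg_nonneg) auto
      also have "\<dots> = K * \<mu>\<^sup>2 * (h * (c * (h * \<psi>1 0)))"
        using h0 by (simp add: power2_eq_square mult_ac)
      also have "\<dots> \<le> K * \<mu>\<^sup>2 * ?X"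
      proof -
        have "\<psi>1 0 \<le> \<psi>1 (ln M)"
          using M(2) by (intro mono1) linarith
        then have "c * (h * \<psi>1 0) \<le> c * (h * \<psi>1 (ln M))"
          using c(1) h0 by (intro mult_left_mono) auto
        also have "\<dots> \<le> \<psi>2 (h * \<psi>1 (ln M))" by (rule c)
        finally show ?thesis
          using K h0 by (intro mult_left_mono) auto
      qed
      finally have "M\<^sup>2 \<le> K * \<mu>\<^sup>2 * ?X" using Mu by simp
      then have "M \<le> sqrt (K * \<mu>\<^sup>2 * ?X)"
        by (rule real_le_rsqrt)
      also have "\<dots> = sqrt K * \<mu> * sqrt ?X"
        using \<mu>0 by (simp add: real_sqrt_mult)
      also have "\<dots> \<le> (D + sqrt K) * \<mu> * sqrt ?X"
        using D \<mu>0 X0 by (intro mult_right_mono) auto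
      finally show ?thesis .
    qed
  qed
qed

section \<open>The main estimate\<close>

text \<open>
  By the maximum principle, a value of \<open>f\<close> exceeding \<open>B\<close> at \<open>z\<close> forces \<open>M(r) > B\<close> for all \<open>r \<ge> |z|\<close>.
\<close>
lemma max_modulus_unbounded:
  fixes R :: ereal
  assumes f: "f analytic_on eball 0 R" and unb: "\<not> bounded (f ` eball 0 R)"
  obtains r0 where "r0 \<in> ico 0 R" "\<And>r. r \<in> ico r0 R \<Longrightarrow> B < max_modulus f r"
proof -
  obtain z where z: "z \<in> eball 0 R" "B < norm (f z)"
    using unb unfolding bounded_iff by (metis image_iff linorder_not_le)
  show ?thesis
  proof (rule that[of "norm z"])
    show "norm z \<in> ico 0 R" using z by (simp add: ico_def in_eball_iff)
    fix r assume "r \<in> ico (norm z) R"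
    then have r: "norm z \<le> r" "ereal r < R" by (auto simp: ico_def)
    have r0: "r \<in> ico 0 R" using r norm_ge_zero[of z] by (auto simp: ico_def simp del: norm_ge_zero)
    have sub: "cball (0::complex) r \<subseteq> eball 0 R"
    proof
      fix w :: complex
      assume "w \<in> cball 0 r"
      then have "ereal (norm w) \<le> ereal r" by simp
      also note r(2)
      finally show "w \<in> eball 0 R" by (simp add: in_eball_iff)
    qed
    note hol = analytic_imp_holomorphic[OF f]
    have "norm (f z) \<le> max_modulus f r"
    proof (rule maximum_modulus_frontier[where S = "cball 0 r" and f = f and \<xi> = z and B = "max_modulus f r"])
      show "f holomorphic_on interior (cball 0 r)"
        by (rule holomorphic_on_subset[OF hol]) (use sub in auto)
      show "continuous_on (closure (cball 0 r)) f"
        using holomorphic_on_imp_continuous_on[OF holomorphic_on_subset[OF hol sub]] by simp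
      show "norm (f w) \<le> max_modulus f r" if "w \<in> frontier (cball 0 r)" for w
        using max_modulus_attained[OF f r0] that by auto
    qed (use r in auto)
    with z show "B < max_modulus f r" by simp
  qed
qed

lemma ico_borel [measurable]: "ico s R \<in> sets borel"
proof -
  have "ico s R = {s..} \<inter> ereal -` {..<R}"
    by (auto simp: ico_def)
  also have "\<dots> \<in> sets borel"
    by (intro sets.Int borel_closed borel_open open_vimage continuous_on_ereal continuous_on_id) auto
  finally show ?thesis .
qed

lemma less_set_borel:
  fixes u v :: "real \<Rightarrow> real"
  assumes J: "J \<in> sets borel"
    and [measurable]: "u \<in> borel_measurable (restrict_space borel J)"
      "v \<in> borel_measurable (restrict_space borel J)"
  shows "{r \<in> J. u r < v r} \<in> sets borel"
proof -
  have "{r \<in> space (restrict_space borel J). u r < v r} \<in> sets (restrict_space borel J)"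
    by measurable
  then show ?thesis
    using J by (simp add: sets_restrict_space_iff space_restrict_space)
qed

theorem theorem2p1:
  fixes R :: ereal and \<rho> a :: real
    and h \<psi>1 \<psi>2 :: "real \<Rightarrow> real"
    and f :: "complex \<Rightarrow> complex"
  assumes "0 < R"
    and "0 < \<rho>" and "ereal \<rho> < R"
    and "\<And>r. r \<in> ico \<rho> R \<Longrightarrow> 0 < h r"
    and "mono_on (ico \<rho> R) h"
    and "(\<integral>\<^sup>+ r \<in> ico \<rho> R. ennreal (h r / r) \<partial>lebesgue) = \<infinity>"
    and "0 < a"
    and "\<And>y. a \<le> y \<Longrightarrow> 0 < \<psi>1 y"
    and "mono_on {a..} \<psi>1"
    and "(\<integral>\<^sup>+ y \<in> {a..}. ennreal (1 / \<psi>1 y) \<partial>lebesgue) < \<infinity>"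
    and "\<And>y. a \<le> y \<Longrightarrow> 0 < \<psi>2 y"
    and "mono_on {a..} \<psi>2"
    and "(\<integral>\<^sup>+ y \<in> {a..}. ennreal (1 / \<psi>2 y) \<partial>lebesgue) < \<infinity>"
    and "f analytic_on eball 0 R"
    and "\<not> bounded (f ` eball 0 R)"
  shows "\<exists>E C. finite_log_measure h \<rho> R E \<and> 0 < C \<and>
    (\<forall>r \<in> ico 0 R - E.
       \<rho> \<le> r \<and>
       0 < max_modulus f r \<and>
       a \<le> ln (max_modulus f r) \<and>
       a \<le> h r * \<psi>1 (ln (max_modulus f r)) \<and>
       max_modulus f r \<le>
         C * max_term f r * sqrt (h r * \<psi>2 (h r * \<psi>1 (ln (max_modulus f r)))))"
proof -
  note h_pos = assms(4) and h_mono = mono_onD[OF assms(5)] and f = assms(14)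
  have \<rho>: "0 < \<rho>" "\<rho> \<in> ico \<rho> R"
    using assms by (auto simp: ico_def)

  define \<Psi>1 \<Psi>2 where "\<Psi>1 = (\<lambda>y. \<psi>1 (max a y))" and "\<Psi>2 = (\<lambda>y. \<psi>2 (max a y))"
  have \<Psi>1: "growth_majorant \<Psi>1" and \<Psi>2: "growth_majorant \<Psi>2"
    using assms unfolding \<Psi>1_def \<Psi>2_def by (blast intro: growth_majorant_extend)+
  define P1 where "P1 = (\<lambda>y. min (\<Psi>1 (1/4 * y)) ((max 1 y)\<^sup>2))"
  define P2 where "P2 = (\<lambda>y. min (\<Psi>2 y) ((max 1 y)\<^sup>2))"
  have P1: "growth_majorant P1" unfolding P1_def
    by (intro growth_majorant_min growth_majorant_dilate \<Psi>1 growth_majorant_square) simp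
  have P2: "growth_majorant P2" unfolding P2_def
    by (intro growth_majorant_min \<Psi>2 growth_majorant_square)

  define b where "b n = norm (fps_nth (fps_expansion f 0) n)" for n
  define S where "S x = (\<Sum>n. b n * x ^ n)" for x
  define S1 where "S1 x = (\<Sum>n. real n * b n * x ^ n)" for x
  define S2 where "S2 x = (\<Sum>n. real n * (real n * b n) * x ^ n)" for x
  define A where "A x = S1 x / S x" for x
  define V where "V x = S2 x / S x - (A x)\<^sup>2" for x
  have b_nonneg: "0 \<le> b n" for n by (simp add: b_def)
  have sm0: "summable (\<lambda>n. b n * x ^ n)" if "0 < x" "ereal x < R" for x
  proof -
    have "ereal (norm (complex_of_real x)) < fps_conv_radius (fps_expansion f 0)"
      using that conv_radius_fps_expansion[OF analytic_imp_holomorphic[OF f]]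
      by (auto intro: less_le_trans)
    from abs_summable_in_conv_radius[OF this[unfolded fps_conv_radius_def]] that show ?thesis
      by (simp add: norm_mult norm_power b_def)
  qed
  have sm1: "summable (\<lambda>n. real n * b n * x ^ n)" if "0 < x" "ereal x < R" for x
    by (rule power_series_euler_operator(1)[where R = R]) (fact sm0 that)+
  have sm2: "summable (\<lambda>n. real n * (real n * b n) * x ^ n)" if "0 < x" "ereal x < R" for x
    by (rule power_series_euler_operator(1)[where R = R]) (fact sm1 that)+
  have S_sums: "(\<lambda>n. b n * x ^ n) sums S x" if "0 < x" "ereal x < R" for x
    using sm0[OF that] by (simp add: S_def summable_sums)
  have S_deriv: "(S has_real_derivative S1 x / x) (at x)" if "0 < x" "ereal x < R" for x
    unfolding S_def[abs_def] S1_def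
    by (rule power_series_euler_operator(2)[where R = R]) (fact sm0 that)+
  have S1_deriv: "(S1 has_real_derivative S2 x / x) (at x)" if "0 < x" "ereal x < R" for x
    unfolding S1_def[abs_def] S2_def
    by (rule power_series_euler_operator(2)[where R = R]) (fact sm1 that)+
  have S2_cont: "isCont S2 x" if "0 < x" "ereal x < R" for x
    unfolding S2_def[abs_def]
    by (rule DERIV_isCont[OF power_series_euler_operator(2)[where R = R]]) (fact sm2 that)+

  have M_le_S: "max_modulus f x \<le> S x" if x: "0 < x" "ereal x < R" for x
  proof -
    have "x \<in> ico 0 R" using x by (simp add: ico_def)
    then obtain z where z: "norm z = x" "max_modulus f x = norm (f z)"
      using max_modulus_attained[OF f, of x] by auto
    have "z \<in> eball 0 R" using z x by (simp add: in_eball_iff)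
    from sums_unique[OF fps_expansion_sums[OF f this]]
    have "norm (f z) = norm (\<Sum>n. fps_nth (fps_expansion f 0) n * z ^ n)" by simp
    also have "\<dots> \<le> (\<Sum>n. norm (fps_nth (fps_expansion f 0) n * z ^ n))"
      using sm0[OF x] z by (intro summable_norm) (simp add: norm_mult norm_power b_def)
    also have "\<dots> = S x"
      using z by (simp add: norm_mult norm_power S_def b_def)
    finally show ?thesis using z by simp
  qed
  have term_le: "b n * x ^ n \<le> max_term f x" if "0 < x" "ereal x < R" for x n
    using max_term_attained[OF f, of x] that by (auto simp: ico_def b_def)

  obtain c where c: "0 < c" "\<And>y. c * y \<le> \<Psi>1 y"
    using growth_majorant_at_least_linear[OF \<Psi>1] by blast
  \<comment> \<open>\<open>T\<close> is such that \<open>ln M \<ge> T\<close> puts \<open>ln M\<close> and \<open>h * \<psi>1 (ln M)\<close> into \<open>{a..}\<close>, the latter because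
    \<open>h * \<psi>1 (ln M) \<ge> h \<rho> * c * ln M\<close>.\<close>
  define T where "T = max 1 (max a (a / (h \<rho> * c)))"
  obtain r0 where r0: "r0 \<in> ico 0 R" "\<And>r. r \<in> ico r0 R \<Longrightarrow> exp T < max_modulus f r"
    using max_modulus_unbounded[OF f assms(15)] by blast
  define r1 where "r1 = max \<rho> r0"
  have r1: "\<rho> \<le> r1" "r1 \<in> ico \<rho> R"
    using r0(1) \<rho> by (auto simp: r1_def ico_def max_def)
  define J where "J = ico r1 R"
  have J_sub: "J \<subseteq> ico \<rho> R" "J \<subseteq> ico r0 R"
    by (auto simp: J_def ico_def r1_def)
  have JD: "0 < r" "ereal r < R" "\<rho> \<le> r" "exp T < max_modulus f r" "1 < S r" if "r \<in> J" for r
  proof -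
    show "0 < r" "ereal r < R" "\<rho> \<le> r" and M: "exp T < max_modulus f r"
      using that r1 \<rho>(1) r0(2) J_sub by (auto simp: J_def ico_def)
    have "1 \<le> exp T" by (simp add: T_def)
    also note M
    also have "max_modulus f r \<le> S r" by (rule M_le_S) fact+
    finally show "1 < S r" .
  qed

  have mean_sums: "(\<lambda>n. real n * (b n * r ^ n)) sums (S r * A r)" if "r \<in> J" for r
    using summable_sums[OF sm1[OF JD(1,2)[OF that]]] JD(5)[OF that] by (simp add: A_def S1_def mult.assoc)
  have second_moment_sums: "(\<lambda>n. real n ^ 2 * (b n * r ^ n)) sums (S r * (V r + (A r)\<^sup>2))" if "r \<in> J" for r
    using summable_sums[OF sm2[OF JD(1,2)[OF that]]] JD(5)[OF that]
    by (simp add: V_def S2_def mult.assoc power2_eq_square)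
  have var_sums: "(\<lambda>n. (real n - A r)\<^sup>2 * (b n * r ^ n)) sums (S r * V r)" if "r \<in> J" for r
    by (intro variance_sums S_sums mean_sums second_moment_sums that JD(1,2)[OF that])
  have A_nonneg: "0 \<le> A r" if "r \<in> J" for r
  proof -
    have "0 \<le> S r * A r"
      using JD(1)[OF that] b_nonneg by (intro sums_le[OF _ sums_zero mean_sums[OF that]]) simp
    then show ?thesis using JD(5)[OF that] by (simp add: zero_le_mult_iff)
  qed
  have V_nonneg: "0 \<le> V r" if "r \<in> J" for r
  proof -
    have "0 \<le> S r * V r"
      using JD(1)[OF that] b_nonneg by (intro sums_le[OF _ sums_zero var_sums[OF that]]) simp
    then show ?thesis using JD(5)[OF that] by (simp add: zero_le_mult_iff)
  qed
  have lnS_deriv: "((\<lambda>r. ln (S r)) has_real_derivative A r / r) (at r)" if "r \<in> J" for r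
    using JD[OF that] by (auto intro!: derivative_eq_intros S_deriv simp: A_def)
  have A_deriv: "(A has_real_derivative V r / r) (at r)" if "r \<in> J" for r
  proof -
    have "(A has_real_derivative (S2 r / r * S r - S1 r * (S1 r / r)) / (S r * S r)) (at r)"
      unfolding A_def[abs_def] using JD[OF that] by (intro DERIV_divide S1_deriv S_deriv) auto
    also have "(S2 r / r * S r - S1 r * (S1 r / r)) / (S r * S r) = V r / r"
      using JD[OF that] by (simp add: V_def A_def field_simps power2_eq_square)
    finally show ?thesis .
  qed
  have S_cont: "continuous_on J S" and A_cont: "continuous_on J A"
    using DERIV_isCont[OF S_deriv] DERIV_isCont[OF A_deriv] JD
    by (auto intro!: continuous_at_imp_continuous_on)
  have V_cont: "continuous_on J V"
  proof -
    have "continuous_on J S2"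
      using S2_cont JD by (auto intro!: continuous_at_imp_continuous_on)
    then show ?thesis unfolding V_def[abs_def]
      by (intro continuous_intros S_cont A_cont) (use JD(5) in force)+
  qed

  \<comment> \<open>Besides the two sets from the growth lemma, \<open>E\<close> contains the radii at which \<open>M\<close> is not yet
    large; on \<open>[\<rho>, r1)\<close> the integrand \<open>h r / r\<close> is bounded by \<open>h r1 / \<rho>\<close>.\<close>
  define E1 where "E1 = {r \<in> J. h r * P1 (ln (S r)) < A r}"
  define E2 where "E2 = {r \<in> J. h r * P2 (A r) < V r}"
  define E where "E = {r \<in> ico 0 R. r < r1} \<union> E1 \<union> E2"
  have J_borel: "J \<in> sets borel" by (simp add: J_def)
  have h_meas: "h \<in> borel_measurable (restrict_space borel J)"
    by (intro borel_measurable_mono_on_fnc mono_on_subset[OF assms(5)] J_sub)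
  note cont_meas = borel_measurable_continuous_on_restrict
  have E1_borel: "E1 \<in> sets borel" unfolding E1_def
  proof (rule less_set_borel[OF J_borel _ cont_meas[OF A_cont]])
    note [measurable] = h_meas growth_majorant_measurable[OF P1] cont_meas[OF S_cont]
    show "(\<lambda>r. h r * P1 (ln (S r))) \<in> borel_measurable (restrict_space borel J)"
      by measurable
  qed
  have E2_borel: "E2 \<in> sets borel" unfolding E2_def
  proof (rule less_set_borel[OF J_borel _ cont_meas[OF V_cont]])
    note [measurable] = h_meas growth_majorant_measurable[OF P2] cont_meas[OF A_cont]
    show "(\<lambda>r. h r * P2 (A r)) \<in> borel_measurable (restrict_space borel J)"
      by measurable
  qed
  have r1R: "ereal r1 < R" using r1 by (simp add: ico_def)
  have E1_fin: "(\<integral>\<^sup>+ r \<in> E1. ennreal (h r / r) \<partial>lborel) < \<infinity>"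
  proof -
    have "(\<integral>\<^sup>+ r \<in> E1. ennreal (h r / r) \<partial>lborel) \<le> (\<integral>\<^sup>+ y \<in> {ln (S r1)..}. ennreal (1 / P1 y) \<partial>lborel)"
    proof (rule exceptional_set_integral_le[OF P1 r1R, folded J_def])
      show "continuous_on J (\<lambda>r. A r / r)"
        by (intro continuous_intros A_cont) (use JD(1) in force)
      show "r \<in> J \<and> h r / r * P1 (ln (S r)) \<le> A r / r" if "r \<in> E1" for r
        using that JD(1)[of r] by (auto simp: E1_def divide_right_mono)
    qed (use lnS_deriv A_nonneg JD(1) in \<open>auto intro!: divide_nonneg_pos\<close>)
    also have "\<dots> < \<infinity>" by (rule growth_majorantD[OF P1])
    finally show ?thesis .
  qed
  have E2_fin: "(\<integral>\<^sup>+ r \<in> E2. ennreal (h r / r) \<partial>lborel) < \<infinity>"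
  proof -
    have "(\<integral>\<^sup>+ r \<in> E2. ennreal (h r / r) \<partial>lborel) \<le> (\<integral>\<^sup>+ y \<in> {A r1..}. ennreal (1 / P2 y) \<partial>lborel)"
    proof (rule exceptional_set_integral_le[OF P2 r1R, folded J_def])
      show "continuous_on J (\<lambda>r. V r / r)"
        by (intro continuous_intros V_cont) (use JD(1) in force)
      show "r \<in> J \<and> h r / r * P2 (A r) \<le> V r / r" if "r \<in> E2" for r
        using that JD(1)[of r] by (auto simp: E2_def divide_right_mono)
    qed (use A_deriv V_nonneg JD(1) in \<open>auto intro!: divide_nonneg_pos\<close>)
    also have "\<dots> < \<infinity>" by (rule growth_majorantD[OF P2])
    finally show ?thesis .
  qed
  have E_small: "finite_log_measure h \<rho> R E"
    unfolding finite_log_measure_def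
  proof (intro conjI)
    show "E \<subseteq> ico 0 R"
      using J_sub \<rho>(1) by (auto simp: E_def E1_def E2_def ico_def)
    have "{r \<in> ico 0 R. r < r1} = ico 0 R \<inter> {..<r1}" by auto
    then have "E \<in> sets borel"
      unfolding E_def using E1_borel E2_borel by auto
    then show "E \<in> sets lebesgue" by auto
    define w where "w r = ennreal (h r / r)" for r
    have w_meas: "(\<lambda>r. w r * indicator B r) \<in> borel_measurable borel"
      if "B \<in> sets borel" "B \<subseteq> J" for B
    proof -
      note [measurable] = that(1)
      have [measurable]: "(\<lambda>r. indicator J r *\<^sub>R h r) \<in> borel_measurable borel"
        using h_meas J_borel by (simp add: borel_measurable_restrict_space_iff)
      have "(\<lambda>r. w r * indicator B r) = (\<lambda>r. ennreal ((indicator J r *\<^sub>R h r) / r) * indicator B r)"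
      proof
        show "w r * indicator B r = ennreal ((indicator J r *\<^sub>R h r) / r) * indicator B r" for r
          using that(2) by (cases "r \<in> B") (auto simp: w_def)
      qed
      also have "\<dots> \<in> borel_measurable borel" by measurable
      finally show ?thesis .
    qed
    have [measurable]: "(\<lambda>r. w r * indicator E1 r) \<in> borel_measurable borel"
      "(\<lambda>r. w r * indicator E2 r) \<in> borel_measurable borel"
      using E1_borel E2_borel by (auto intro!: w_meas simp: E1_def E2_def)
    have "(\<integral>\<^sup>+ r \<in> E \<inter> ico \<rho> R. w r \<partial>lebesgue) = (\<integral>\<^sup>+ r. w r * indicator (E \<inter> ico \<rho> R) r \<partial>lborel)"
      by (simp add: nn_integral_completion)
    also have "\<dots> \<le> (\<integral>\<^sup>+ r. ennreal (h r1 / \<rho>) * indicator {\<rho>..r1} r +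
        (w r * indicator E1 r + w r * indicator E2 r) \<partial>lborel)"
    proof (rule nn_integral_mono)
      fix r
      consider "r \<notin> E \<inter> ico \<rho> R" | "r \<in> E1" | "r \<in> E2" | "r \<in> ico \<rho> R" "r < r1"
        by (auto simp: E_def)
      then show "w r * indicator (E \<inter> ico \<rho> R) r \<le> ennreal (h r1 / \<rho>) * indicator {\<rho>..r1} r +
          (w r * indicator E1 r + w r * indicator E2 r)"
      proof cases
        case 4
        then have "h r / r \<le> h r1 / \<rho>"
          using h_mono[OF 4(1) r1(2)] h_pos[OF 4(1)] \<rho>(1) by (intro frac_le) (auto simp: ico_def)
        then have "w r \<le> ennreal (h r1 / \<rho>)" by (simp add: w_def ennreal_leI)
        also have "\<dots> \<le> \<dots> + (w r * indicator E1 r + w r * indicator E2 r)" by simp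
        finally show ?thesis using 4 by (auto simp: ico_def split: split_indicator)
      qed (auto split: split_indicator)
    qed
    also have "\<dots> = ennreal (h r1 / \<rho>) * emeasure lborel {\<rho>..r1} +
        ((\<integral>\<^sup>+ r. w r * indicator E1 r \<partial>lborel) + (\<integral>\<^sup>+ r. w r * indicator E2 r \<partial>lborel))"
      by (subst nn_integral_add; (subst nn_integral_add)?) (auto simp: nn_integral_cmult_indicator)
    also have "\<dots> < \<infinity>"
      using E1_fin E2_fin by (auto simp: w_def emeasure_lborel_Icc_eq ennreal_mult_less_top)
    finally show "(\<integral>\<^sup>+ r \<in> E \<inter> ico \<rho> R. ennreal (h r / r) \<partial>lebesgue) < \<infinity>"
      by (simp add: w_def)
  qed

  have "r1 \<in> J" using r1 by (simp add: J_def ico_def)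
  \<comment> \<open>A single nonvanishing coefficient bounds the maximum term from below on \<open>[\<rho>, R)\<close>.\<close>
  have "\<exists>k. b k \<noteq> 0"
  proof (rule ccontr)
    assume "\<not> ?thesis"
    then have "S r1 = 0" by (simp add: S_def)
    with JD(5)[OF \<open>r1 \<in> J\<close>] show False by simp
  qed
  then obtain k where k: "0 < b k" using b_nonneg by (metis order_le_less)
  define m where "m = b k * \<rho> ^ k"
  have m: "0 < m" using k \<rho> by (simp add: m_def)
  obtain C where C: "0 < C"
    "\<And>h' \<mu> M S A V. \<lbrakk>h \<rho> \<le> h'; m \<le> \<mu>; 0 < M; 1 \<le> ln M; M \<le> S;
       A \<le> h' * min (\<Psi>1 (1/4 * ln S)) ((max 1 (ln S))\<^sup>2);
       V \<le> h' * min (\<Psi>2 A) ((max 1 A)\<^sup>2);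
       \<And>W. V \<le> W \<Longrightarrow> 0 < W \<Longrightarrow> S \<le> 2 * \<mu> * (2 * sqrt (2 * W) + 1)\<rbrakk> \<Longrightarrow>
       M \<le> C * \<mu> * sqrt (h' * \<Psi>2 (h' * \<Psi>1 (ln M)))"
    using modulus_estimate[OF \<Psi>1 \<Psi>2 h_pos[OF \<rho>(2)] m] by blast

  have "\<rho> \<le> r \<and> 0 < max_modulus f r \<and> a \<le> ln (max_modulus f r) \<and>
      a \<le> h r * \<psi>1 (ln (max_modulus f r)) \<and>
      max_modulus f r \<le> C * max_term f r * sqrt (h r * \<psi>2 (h r * \<psi>1 (ln (max_modulus f r))))"
    if r: "r \<in> ico 0 R - E" for r
  proof -
    have rJ: "r \<in> J" using r by (auto simp: J_def E_def ico_def)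
    note J = JD[OF rJ]
    let ?M = "max_modulus f r"
    have M0: "0 < ?M" using J(4) exp_gt_zero[of T] by linarith
    have "T \<le> ln ?M" using J(4) M0 by (simp add: ln_ge_iff)
    then have M: "1 \<le> ln ?M" "a \<le> ln ?M" "a / (h \<rho> * c) \<le> ln ?M"
      by (auto simp: T_def)
    have h\<rho>: "0 < h \<rho>" "h \<rho> \<le> h r"
      using h_pos[OF \<rho>(2)] h_mono[OF \<rho>(2), of r] rJ J_sub J(3) by auto
    have \<Psi>1_eq: "\<Psi>1 (ln ?M) = \<psi>1 (ln ?M)" using M by (simp add: \<Psi>1_def max_def)
    have "a \<le> h \<rho> * (c * ln ?M)"
      using M(3) h\<rho> c by (simp add: field_simps)
    also have "\<dots> \<le> h r * \<Psi>1 (ln ?M)"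
      using h\<rho> c M(1) by (intro mult_mono) auto
    finally have a_le: "a \<le> h r * \<Psi>1 (ln ?M)" .
    have "?M \<le> C * max_term f r * sqrt (h r * \<Psi>2 (h r * \<Psi>1 (ln ?M)))"
    proof (rule C(2)[OF h\<rho>(2) _ M0 M(1) M_le_S[OF J(1,2)]])
      have "m \<le> b k * r ^ k"
        unfolding m_def using \<rho> J b_nonneg by (intro mult_left_mono power_mono) auto
      also have "\<dots> \<le> max_term f r" by (rule term_le[OF J(1,2)])
      finally show "m \<le> max_term f r" .
      show "A r \<le> h r * min (\<Psi>1 (1/4 * ln (S r))) ((max 1 (ln (S r)))\<^sup>2)"
        using r rJ by (auto simp: E_def E1_def P1_def)
      show "V r \<le> h r * min (\<Psi>2 (A r)) ((max 1 (A r))\<^sup>2)"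
        using r rJ by (auto simp: E_def E2_def P2_def)
      show "S r \<le> 2 * max_term f r * (2 * sqrt (2 * W) + 1)" if "V r \<le> W" "0 < W" for W
        by (rule sum_le_max_term_times_deviation[OF _ term_le[OF J(1,2)] S_sums[OF J(1,2)] var_sums[OF rJ] that])
          (use J b_nonneg in auto)
    qed
    with M0 M(2) J(3) a_le show ?thesis
      by (simp add: \<Psi>1_eq) (simp add: \<Psi>2_def max_def)
  qed
  with E_small C(1) show ?thesis by blast
qed

end
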